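(* The Pellarin $L$-series $L(\chi_t^\beta,s)$ analytically continues to an entire function on $\mathbb{S}_\infty$; that is, for each fixed $y\in\mathbb{Z}_p$, the series $\sum_{j=0}^\infty x^{-j}\left(\sum_{a\in A_+(j)}\chi_t(a)^\beta\langle a\rangle^{-y}\right)$ is an entire power series in $x^{-1}$ (converging for all $x\in\mathbb{C}_\infty^\ast$), and the resulting function on $\mathbb{S}_\infty$ has the continuity properties required of entire functions on $\mathbb{S}_\infty$ (as in Goss, Basic Structures of Function Field Arithmetic).
   Context: Let $p$ be a prime, $q=p^{m_0}$, $A=\mathbb{F}_q[\theta]$, $K=\mathbb{F}_q((1/\theta))$ with absolute value $\vert\cdot\vert_\infty$ normalized by $\vert\theta\vert_\infty=q$, and $\mathbb{C}_\infty$ the completion of an algebraic closure of $K$. Let $A_+$ be the monic elements of $A$ and $A_+(j)$ the monics of degree $j$. For $a\in A_+$ put $\langle a\rangle:=\theta^{-\deg a}a$. Let $\mathbb{S}_\infty:=\mathbb{C}_\infty^\ast\times\mathbb{Z}_p$, and for $s=(x,y)\in\mathbb{S}_\infty$, $a\in A_+$, set $a^s:=x^{\deg a}\langle a\rangle^y$. For $t\in\mathbb{C}_\infty$ and $f\in A$ let $\chi_t(f):=f(t)$. For a nonnegative integer $\beta$, the Pellarin $L$-series is $L(\chi_t^\beta,s):=\sum_{a\in A_+}\chi_t(a)^\beta a^{-s}$, which converges for $\vert x\vert_\infty>\max\{1,\vert t\vert_\infty\}^\beta$, where it equals $\sum_{j\ge0}x^{-j}\sum_{a\in A_+(j)}\chi_t(a)^\beta\langle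 a\rangle^{-y}$. *)

theory Defs
  imports "HOL-Analysis.Analysis" "HOL-Computational_Algebra.Computational_Algebra"
begin

section \<open>Non-archimedean valued fields\<close>

text \<open>
  The metric and the topology are the ones induced by the absolute value, so positivity and
  definiteness of \<open>vabs\<close> come from the metric space axioms.  (The library's \<^const>\<open>norm\<close> is
  reserved for real normed spaces.)
\<close>

class nonarch_valued_field = field + metric_space +
  fixes vabs :: "'a \<Rightarrow> real"
  assumes dist_vabs: "dist x y = vabs (x - y)"
    and vabs_mult: "vabs (x * y) = vabs x * vabs y"
    and vabs_ultrametric: "vabs (x + y) \<le> max (vabs x) (vabs y)"

lemma vabs_zero: "vabs (0 :: 'a::nonarch_valued_field) = 0"
  using dist_vabs[of 0 "0 :: 'a"] by simp

lemma vabs_nonneg: "vabs (x :: 'a::nonarch_valued_field) \<ge> 0"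
  using dist_vabs[of x 0] zero_le_dist[of x 0] by simp

lemma vabs_one: "vabs (1 :: 'a::nonarch_valued_field) = 1"
proof -
  have "vabs (1 :: 'a) \<noteq> 0"
    using dist_vabs[of 1 "0 :: 'a"] by (metis diff_zero dist_eq_0_iff zero_neq_one)
  thus ?thesis
    using vabs_mult[of 1 "1 :: 'a"] by simp
qed

lemma vabs_power: "vabs ((x :: 'a::nonarch_valued_field) ^ n) = vabs x ^ n"
  by (induction n) (simp_all add: vabs_one vabs_mult)



section \<open>The rings A and K\<close>

text \<open>
  The field with \<open>q\<close> elements is a type \<open>'k :: {field, finite}\<close> with \<open>q = CARD('k)\<close>, the
  ring \<open>A\<close> is \<open>'k poly\<close>, and \<open>K\<close> is \<open>'k fls\<close>, whose formal variable plays the role of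
  \<open>1/\<theta>\<close>.  Thus \<open>\<theta>\<close> is \<^const>\<open>fls_X_inv\<close>.
\<close>

definition K_abs :: "'k::{field,finite} fls \<Rightarrow> real" where
  "K_abs f = (if f = 0 then 0 else real CARD('k) powi (- fls_subdegree f))"

definition A_to_K :: "'k::{field,finite} poly \<Rightarrow> 'k fls" where
  "A_to_K a = poly (map_poly fls_const a) fls_X_inv"

definition A_plus :: "'k::{field,finite} poly set" where
  "A_plus = {a. lead_coeff a = 1}"

definition A_plus_deg :: "nat \<Rightarrow> 'k::{field,finite} poly set" where
  "A_plus_deg j = {a \<in> A_plus. degree a = j}"

definition bracket :: "'k::{field,finite} poly \<Rightarrow> 'k fls" where
  "bracket a = A_to_K a / fls_X_inv ^ degree a"


section \<open>The completion of an algebraic closure of K\<close>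

text \<open>
  \<open>is_C_infinity \<iota>\<close> says that the complete valued field \<open>'c\<close>, viewed as an extension of \<open>K\<close>
  through \<open>\<iota>\<close>, is the completion of an algebraic closure \<open>L\<close> of \<open>K\<close>: the absolute value of
  \<open>'c\<close> extends the one of \<open>K\<close>, and \<open>'c\<close> has a dense subfield \<open>L\<close> which is algebraic over \<open>K\<close>
  and algebraically closed.  This determines \<open>'c\<close> up to isometric isomorphism over \<open>K\<close>.
\<close>

definition is_algebraic_closure_in ::
    "('k::{field,finite} fls \<Rightarrow> 'c::field) \<Rightarrow> 'c set \<Rightarrow> bool" where
  "is_algebraic_closure_in \<iota> L \<longleftrightarrow>
     range \<iota> \<subseteq> L \<and>
     (\<forall>z\<in>L. \<forall>w\<in>L. z + w \<in> L \<and> z * w \<in> L) \<and>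
     (\<forall>z\<in>L. - z \<in> L \<and> inverse z \<in> L) \<and>
     (\<forall>z\<in>L. \<exists>P. P \<noteq> 0 \<and> poly (map_poly \<iota> P) z = 0) \<and>
     (\<forall>Q. (\<forall>i. coeff Q i \<in> L) \<and> degree Q > 0 \<longrightarrow> (\<exists>z\<in>L. poly Q z = 0))"

definition is_C_infinity ::
    "('k::{field,finite} fls \<Rightarrow> 'c::{nonarch_valued_field,complete_space}) \<Rightarrow> bool" where
  "is_C_infinity \<iota> \<longleftrightarrow>
     \<iota> 1 = 1 \<and>
     (\<forall>f g. \<iota> (f + g) = \<iota> f + \<iota> g) \<and>
     (\<forall>f g. \<iota> (f * g) = \<iota> f * \<iota> g) \<and>
     (\<forall>f. vabs (\<iota> f) = K_abs f) \<and>
     (\<exists>L. is_algebraic_closure_in \<iota> L \<and> closure L = UNIV)"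


section \<open>The p-adic integers and exponentiation of 1-units\<close>

text \<open>
  The ring of \<open>p\<close>-adic integers is the inverse limit of the rings of integers modulo \<open>p ^ n\<close>:
  \<open>y n\<close> is the residue of \<open>y\<close> in \<open>{0..<p ^ n}\<close>.  Its \<open>p\<close>-adic topology is the subspace
  topology inherited from the product topology on \<^typ>\<open>nat \<Rightarrow> int\<close>, \<^typ>\<open>int\<close> being discrete.
\<close>

definition padic_ints :: "nat \<Rightarrow> (nat \<Rightarrow> int) set" where
  "padic_ints p = {y. \<forall>n. y n \<in> {0..<int p ^ n} \<and> y (Suc n) mod int p ^ n = y n}"

definition padic_uminus :: "nat \<Rightarrow> (nat \<Rightarrow> int) \<Rightarrow> (nat \<Rightarrow> int)" where
  "padic_uminus p y = (\<lambda>n. (- y n) mod int p ^ n)"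

text \<open>
  The power \<open>u ^ y\<close> of a 1-unit \<open>u\<close> (that is, \<open>vabs (u - 1) < 1\<close>) in characteristic \<open>p\<close> is the
  continuous extension of \<open>n \<mapsto> u ^ n\<close>; the residues \<open>y n\<close> are natural numbers converging
  \<open>p\<close>-adically to \<open>y\<close>.
\<close>

definition one_unit_pow :: "'c::nonarch_valued_field \<Rightarrow> (nat \<Rightarrow> int) \<Rightarrow> 'c" where
  "one_unit_pow u y = lim (\<lambda>n. u ^ nat (y n))"

lemma one_unit_pow_convergent:
  fixes u :: "'c::{nonarch_valued_field,complete_space}"
  assumes "prime p" and char: "CHAR('c) = p" and u: "vabs (u - 1) < 1"
    and y: "y \<in> padic_ints p"
  shows "(\<lambda>n. u ^ nat (y n)) \<longlonglongrightarrow> one_unit_pow u y"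
proof -
  define r where "r = vabs (u - 1)"
  have r: "0 \<le> r" "r < 1"
    using u by (simp_all add: r_def vabs_nonneg)
  have "vabs u \<le> 1"
    using vabs_ultrametric[of "u - 1" 1] u by (simp add: vabs_one)
  have pow: "vabs (u ^ k - 1) \<le> r" for k
  proof (induction k)
    case 0
    show ?case using r by (simp add: vabs_zero)
  next
    case (Suc k)
    have "vabs (u * (u ^ k - 1)) \<le> 1 * r"
      unfolding vabs_mult using Suc \<open>vabs u \<le> 1\<close> by (intro mult_mono) (auto simp: vabs_nonneg)
    moreover have "u ^ Suc k - 1 = u * (u ^ k - 1) + (u - 1)"
      by (simp add: algebra_simps)
    ultimately show ?case
      using vabs_ultrametric[of "u * (u ^ k - 1)" "u - 1"] by (simp only: r_def max.absorb2)
  qed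
  define s where "s = (\<lambda>n. u ^ nat (y n))"
  have step: "dist (s (Suc n)) (s n) \<le> r ^ n" for n
  proof -
    have yn: "0 \<le> y n" "0 \<le> y (Suc n)" "y (Suc n) mod int p ^ n = y n"
      using y by (auto simp: padic_ints_def)
    define k where "k = nat (y (Suc n) div int p ^ n)"
    have "y (Suc n) = y n + int p ^ n * int k"
      using yn mult_div_mod_eq[of "int p ^ n" "y (Suc n)"] by (simp add: k_def pos_imp_zdiv_nonneg_iff div_int_pos_iff)
    hence "int (nat (y (Suc n))) = int (nat (y n) + p ^ n * k)"
      using yn by simp
    hence "nat (y (Suc n)) = nat (y n) + p ^ n * k"
      by linarith
    hence "s (Suc n) = s n * ((u ^ k - 1) + 1) ^ (p ^ n)"
      by (simp add: s_def power_add power_mult mult.commute flip: power_mult)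
    also have "((u ^ k - 1) + 1) ^ (p ^ n) = (u ^ k - 1) ^ (p ^ n) + 1"
      using freshmans_dream'[of "p ^ n" n "u ^ k - 1" 1] assms by simp
    finally have "dist (s (Suc n)) (s n) = vabs u ^ nat (y n) * vabs (u ^ k - 1) ^ (p ^ n)"
      by (simp add: dist_vabs s_def algebra_simps vabs_mult vabs_power)
    also have "\<dots> \<le> 1 * r ^ (p ^ n)"
      using pow[of k] \<open>vabs u \<le> 1\<close>
      by (intro mult_mono power_mono power_le_one) (auto simp: vabs_nonneg)
    also have "\<dots> \<le> r ^ n"
    proof -
      have "n \<le> p ^ n"
        using power_gt_expt[of p n] prime_gt_1_nat[OF \<open>prime p\<close>] by simp
      thus ?thesis
        using r by (simp add: power_decreasing)
    qed
    finally show ?thesis .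
  qed
  have far: "dist (s (N + i)) (s N) \<le> r ^ N" for N i
  proof (induction i)
    case (Suc i)
    have "dist (s (Suc (N + i))) (s (N + i)) \<le> r ^ N"
      by (rule order_trans[OF step]) (use r in \<open>simp add: power_decreasing\<close>)
    thus ?case
      using Suc vabs_ultrametric[of "s (Suc (N + i)) - s (N + i)" "s (N + i) - s N"]
      by (simp add: dist_vabs)
  qed (use r in simp)
  have "Cauchy s"
  proof (rule metric_CauchyI)
    fix e :: real assume "e > 0"
    then obtain N where N: "r ^ N < e / 2"
      using real_arch_pow_inv[of "e / 2" r] r by auto
    have "dist (s m) (s n) < e" if "m \<ge> N" "n \<ge> N" for m n
      using far[of N "m - N"] far[of N "n - N"] that N
        dist_triangle2[of "s m" "s n" "s N"] by simp
    thus "\<exists>M. \<forall>m\<ge>M. \<forall>n\<ge>M. dist (s m) (s n) < e"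
      by blast
  qed
  thus ?thesis
    by (simp add: Cauchy_convergent_iff convergent_LIMSEQ_iff one_unit_pow_def flip: s_def)
qed


section \<open>The space of exponents and entire functions on it\<close>

definition S_infinity :: "nat \<Rightarrow> ('c::nonarch_valued_field \<times> (nat \<Rightarrow> int)) set" where
  "S_infinity p = (UNIV - {0}) \<times> padic_ints p"

definition S_uminus :: "nat \<Rightarrow> 'c::nonarch_valued_field \<times> (nat \<Rightarrow> int) \<Rightarrow> 'c \<times> (nat \<Rightarrow> int)" where
  "S_uminus p s = (inverse (fst s), padic_uminus p (snd s))"

definition S_pow :: "('k::{field,finite} fls \<Rightarrow> 'c::nonarch_valued_field) \<Rightarrow>
    'k poly \<Rightarrow> 'c \<times> (nat \<Rightarrow> int) \<Rightarrow> 'c" where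
  "S_pow \<iota> a s = fst s ^ degree a * one_unit_pow (\<iota> (bracket a)) (snd s)"

definition entire_power_series :: "(nat \<Rightarrow> 'c::nonarch_valued_field) \<Rightarrow> bool" where
  "entire_power_series c \<longleftrightarrow> (\<forall>u. summable (\<lambda>j. c j * u ^ j))"

text \<open>
  An entire function on \<open>S_infinity p\<close> is a family of entire power series in \<open>inverse x\<close>,
  depending continuously on \<open>y\<close> for the topology of uniform convergence on bounded sets.  The
  continuity in both variables jointly is a consequence, listed here for definiteness.
\<close>

definition entire_on_S_infinity ::
    "nat \<Rightarrow> ('c::nonarch_valued_field \<times> (nat \<Rightarrow> int) \<Rightarrow> 'c) \<Rightarrow> bool" where
  "entire_on_S_infinity p F \<longleftrightarrow>
     (\<exists>c :: (nat \<Rightarrow> int) \<Rightarrow> nat \<Rightarrow> 'c.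
        (\<forall>y\<in>padic_ints p. entire_power_series (c y)) \<and>
        (\<forall>(x, y)\<in>S_infinity p. F (x, y) = (\<Sum>j. c y j * inverse x ^ j)) \<and>
        (\<forall>y0\<in>padic_ints p. \<forall>R. uniform_limit (cball 0 R)
            (\<lambda>y u. \<Sum>j. c y j * u ^ j) (\<lambda>u. \<Sum>j. c y0 j * u ^ j) (at y0 within padic_ints p))) \<and>
     continuous_on (S_infinity p) F"


section \<open>The Pellarin L-series\<close>

definition chi :: "('k::{field,finite} fls \<Rightarrow> 'c::nonarch_valued_field) \<Rightarrow> 'c \<Rightarrow> 'k poly \<Rightarrow> 'c" where
  "chi \<iota> t f = poly (map_poly (\<lambda>c. \<iota> (fls_const c)) f) t"

definition pellarin_term :: "nat \<Rightarrow> ('k::{field,finite} fls \<Rightarrow> 'c::nonarch_valued_field) \<Rightarrow>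
    nat \<Rightarrow> 'c \<Rightarrow> 'c \<times> (nat \<Rightarrow> int) \<Rightarrow> 'k poly \<Rightarrow> 'c" where
  "pellarin_term p \<iota> \<beta> t s a = chi \<iota> t a ^ \<beta> * S_pow \<iota> a (S_uminus p s)"

definition pellarin_L :: "nat \<Rightarrow> ('k::{field,finite} fls \<Rightarrow> 'c::nonarch_valued_field) \<Rightarrow>
    nat \<Rightarrow> 'c \<Rightarrow> 'c \<times> (nat \<Rightarrow> int) \<Rightarrow> 'c" where
  "pellarin_L p \<iota> \<beta> t s = infsum (pellarin_term p \<iota> \<beta> t s) A_plus"

definition pellarin_coeff :: "nat \<Rightarrow> ('k::{field,finite} fls \<Rightarrow> 'c::nonarch_valued_field) \<Rightarrow>
    nat \<Rightarrow> 'c \<Rightarrow> (nat \<Rightarrow> int) \<Rightarrow> nat \<Rightarrow> 'c" where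
  "pellarin_coeff p \<iota> \<beta> t y j =
     (\<Sum>a\<in>A_plus_deg j. chi \<iota> t a ^ \<beta> * one_unit_pow (\<iota> (bracket a)) (padic_uminus p y))"

end

theory Submission
  imports Defs "HOL-Real_Asymp.Real_Asymp"
begin

text \<open>
  Write \<open>q = CARD('k)\<close>.  For \<open>a\<close> monic, \<open>\<langle>a\<rangle>\<close> is a 1-unit with \<open>vabs (\<langle>a\<rangle> - 1) \<le> 1 / q\<close>, so in
  characteristic \<open>p\<close> replacing the exponent \<open>-y\<close> of \<open>\<langle>a\<rangle>\<close> by its residue \<open>N\<close> modulo \<open>p ^ n\<close> costs an
  error of at most \<open>q ^ - p ^ n\<close>.  By Frobenius, \<open>a(t) ^ \<beta> * \<langle>a\<rangle> ^ N\<close> is a product of at most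
  \<open>\<beta> + p * n\<close> additive functions of \<open>a\<close>, and its sum over the monics of degree \<open>j\<close> vanishes when
  \<open>\<beta> + p * n < j\<close>, because every monomial of the expanded product misses one of the \<open>j\<close> free
  coefficients of \<open>a\<close>.  Taking \<open>n\<close> proportional to \<open>j\<close>, the \<open>j\<close>-th coefficient decays like
  \<open>q ^ - p ^ n\<close>, faster than any geometric sequence and uniformly in \<open>y\<close>.
\<close>

section \<open>Ultrametric estimates\<close>

lemma vabs_diff_commute: "vabs (x - y) = vabs (y - x :: 'a::nonarch_valued_field)"
  by (metis dist_commute dist_vabs)

lemma vabs_minus: "vabs (- x) = vabs (x :: 'a::nonarch_valued_field)"
  using vabs_diff_commute[of 0 x] by simp

lemma vabs_add_le:
  "vabs x \<le> e \<Longrightarrow> vabs y \<le> e \<Longrightarrow> vabs (x + y :: 'a::nonarch_valued_field) \<le> e"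
  using vabs_ultrametric[of x y] by simp

lemma vabs_diff_le:
  "vabs x \<le> e \<Longrightarrow> vabs y \<le> e \<Longrightarrow> vabs (x - y :: 'a::nonarch_valued_field) \<le> e"
  using vabs_add_le[of x e "- y"] by (simp add: vabs_minus)

lemma vabs_sum_le:
  fixes f :: "'b \<Rightarrow> 'a::nonarch_valued_field"
  assumes "0 \<le> e" "\<And>i. i \<in> I \<Longrightarrow> vabs (f i) \<le> e"
  shows "vabs (sum f I) \<le> e"
  using assms(2)
  by (induction I rule: infinite_finite_induct) (auto simp: assms(1) vabs_zero intro: vabs_add_le)

lemma vabs_eq_0_iff: "vabs x = 0 \<longleftrightarrow> x = (0 :: 'a::nonarch_valued_field)"
  using dist_vabs[of x 0] by auto

lemma vabs_inverse: "vabs (inverse x) = inverse (vabs (x :: 'a::nonarch_valued_field))"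
proof (cases "x = 0")
  case False
  then have "vabs x * vabs (inverse x) = 1"
    by (simp add: vabs_one flip: vabs_mult)
  then show ?thesis
    by (metis inverse_unique)
qed (simp add: vabs_zero)

lemma vabs_divide: "vabs (x / y) = vabs x / vabs (y :: 'a::nonarch_valued_field)"
  by (simp add: divide_inverse vabs_mult vabs_inverse)

text \<open>The isosceles triangle principle: if \<open>vabs x\<close> were smaller than
  \<open>vabs y\<close>, then \<open>y = (y - x) + x\<close> would violate the ultrametric
  inequality.\<close>

lemma vabs_eq_of_diff_less:
  fixes x y :: "'a::nonarch_valued_field"
  assumes "vabs (x - y) < vabs y"
  shows "vabs x = vabs y"
  using assms vabs_ultrametric[of "x - y" y] vabs_ultrametric[of "y - x" x]
  by (simp add: vabs_diff_commute)

text \<open>Telescoping; the ultrametric inequality avoids the factor \<open>j\<close> of the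
  archimedean estimate. It serves both for powers of 1-units (\<open>v = 1\<close>,
  \<open>R = 1\<close>) and for the Lipschitz bound on power series.\<close>

lemma vabs_power_diff_le:
  fixes u v :: "'a::nonarch_valued_field"
  assumes "vabs u \<le> R" "vabs v \<le> R" "1 \<le> R"
  shows "vabs (u ^ j - v ^ j) \<le> R ^ j * vabs (u - v)"
proof (induction j)
  case (Suc j)
  have R: "R ^ j \<le> R ^ Suc j"
    using assms by (intro power_increasing) auto
  have "vabs (u * (u ^ j - v ^ j)) \<le> R * (R ^ j * vabs (u - v))"
    unfolding vabs_mult using assms Suc by (intro mult_mono) (auto simp: vabs_nonneg)
  moreover have "vabs ((u - v) * v ^ j) \<le> vabs (u - v) * R ^ Suc j"
    unfolding vabs_mult vabs_power
    using assms power_mono[of "vabs v" R j] R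
    by (intro mult_mono) (auto simp: vabs_nonneg intro: order.trans)
  moreover have "u ^ Suc j - v ^ Suc j = u * (u ^ j - v ^ j) + (u - v) * v ^ j"
    by (simp add: algebra_simps)
  ultimately show ?case
    by (simp add: mult_ac vabs_add_le)
qed (simp add: vabs_zero vabs_nonneg)

lemma vabs_mult_power_le:
  assumes "vabs u \<le> R" "vabs a * R ^ j \<le> e"
  shows "vabs (a * u ^ j :: 'a::nonarch_valued_field) \<le> e"
proof -
  have "vabs a * vabs u ^ j \<le> vabs a * R ^ j"
    using assms(1) by (intro mult_left_mono power_mono) (auto simp: vabs_nonneg)
  then show ?thesis
    using assms(2) by (simp add: vabs_mult vabs_power)
qed

section \<open>Limits and series in ultrametric fields\<close>

lemma vabs_LIMSEQ_le:
  fixes f g :: "nat \<Rightarrow> 'a::nonarch_valued_field"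
  assumes "f \<longlonglongrightarrow> a" "g \<longlonglongrightarrow> b" "\<And>n. n \<ge> N \<Longrightarrow> vabs (f n - g n) \<le> e"
  shows "vabs (a - b) \<le> e"
proof -
  have "(\<lambda>n. dist (f n) (g n)) \<longlonglongrightarrow> dist a b"
    by (intro tendsto_dist assms)
  then show ?thesis
    unfolding dist_vabs by (rule LIMSEQ_le_const2) (use assms(3) in blast)
qed

text \<open>Any block of terms is no larger than its largest member, so null terms already make the
  partial sums Cauchy.\<close>

lemma summable_of_vabs_tendsto_0:
  fixes f :: "nat \<Rightarrow> 'a::{nonarch_valued_field,complete_space}"
  assumes "(\<lambda>n. vabs (f n)) \<longlonglongrightarrow> 0"
  shows "summable f"
proof -
  have "Cauchy (\<lambda>n. \<Sum>i<n. f i)"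
  proof (rule metric_CauchyI)
    fix e :: real assume "e > 0"
    then obtain N where N: "\<And>n. n \<ge> N \<Longrightarrow> vabs (f n) < e / 3"
      using order_tendstoD(2)[OF assms, of "e / 3"] by (auto simp: eventually_sequentially)
    have near: "dist (\<Sum>i<n. f i) (\<Sum>i<N. f i) \<le> e / 3" if "n \<ge> N" for n
    proof -
      have "(\<Sum>i<n. f i) - (\<Sum>i<N. f i) = (\<Sum>i\<in>{..<n} - {..<N}. f i)"
        using that by (subst sum_diff) auto
      moreover have "vabs (\<Sum>i\<in>{..<n} - {..<N}. f i) \<le> e / 3"
        using \<open>e > 0\<close> N by (intro vabs_sum_le) (auto intro: less_imp_le)
      ultimately show ?thesis
        by (simp add: dist_vabs)
    qed
    have "dist (\<Sum>i<m. f i) (\<Sum>i<n. f i) < e" if "m \<ge> N" "n \<ge> N" for m n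
      using dist_triangle2[of "\<Sum>i<m. f i" "\<Sum>i<n. f i" "\<Sum>i<N. f i"]
        near[OF that(1)] near[OF that(2)] \<open>e > 0\<close>
      by linarith
    then show "\<exists>M. \<forall>m\<ge>M. \<forall>n\<ge>M. dist (\<Sum>i<m. f i) (\<Sum>i<n. f i) < e"
      by blast
  qed
  then show ?thesis
    by (simp add: summable_iff_convergent Cauchy_convergent_iff)
qed

lemma vabs_suminf_diff_le:
  fixes f g :: "nat \<Rightarrow> 'a::nonarch_valued_field"
  assumes "summable f" "summable g" "\<And>n. vabs (f n - g n) \<le> e"
  shows "vabs (suminf f - suminf g) \<le> e"
proof (rule vabs_LIMSEQ_le)
  have "0 \<le> e"
    using assms(3)[of 0] vabs_nonneg order.trans by blast
  then show "vabs ((\<Sum>i<n. f i) - (\<Sum>i<n. g i)) \<le> e" for n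
    unfolding sum_subtractf[symmetric] by (intro vabs_sum_le assms(3))
qed (use assms in \<open>auto intro: summable_LIMSEQ\<close>)

lemma vabs_suminf_tail_le:
  fixes f :: "nat \<Rightarrow> 'a::nonarch_valued_field"
  assumes "summable f" "0 \<le> e" "\<And>n. n \<ge> N \<Longrightarrow> vabs (f n) \<le> e"
  shows "vabs (suminf f - (\<Sum>i<N. f i)) \<le> e"
proof -
  \<comment> \<open>Padding the partial sum with zeros turns it into a series, which reduces the
    tail bound to a termwise comparison.\<close>
  have *: "(\<lambda>i. if i \<in> {..<N} then f i else 0) sums (\<Sum>i<N. f i)"
    by (rule sums_If_finite_set) simp
  have "vabs (suminf f - suminf (\<lambda>i. if i \<in> {..<N} then f i else 0)) \<le> e"
    using assms by (intro vabs_suminf_diff_le sums_summable[OF *]) (auto simp: vabs_zero)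
  then show ?thesis
    using sums_unique[OF *] by simp
qed

text \<open>The exponent of \<open>1 / q\<close> grows exponentially in \<open>j\<close>, so that
  factor decays doubly exponentially and beats \<open>D ^ j\<close>.\<close>

lemma LIMSEQ_superexponential:
  fixes D q :: real and p b :: nat
  assumes "D \<ge> 0" "q \<ge> 2" "p \<ge> 2"
  shows "(\<lambda>j. D ^ j * (1 / q) ^ (p ^ ((j - b) div p))) \<longlonglongrightarrow> 0"
proof -
  \<comment> \<open>A base above 1, since \<open>D\<close> itself may be too small for its powers to
    increase with the exponent.\<close>
  define E where "E = D + 2"
  have E: "E > 1" "D \<le> E"
    using assms by (auto simp: E_def)
  have "E ^ p > 1"
    using E assms by (intro one_less_power) auto
  then have "(\<lambda>n. (E ^ p) ^ n * (1 / 2) ^ (2 ^ n)) \<longlonglongrightarrow> 0"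
    by real_asymp
  then have "(\<lambda>n. E ^ (p + b) * ((E ^ p) ^ n * (1 / 2) ^ (2 ^ n))) \<longlonglongrightarrow> 0"
    by (rule tendsto_mult_right_zero)
  moreover have "filterlim (\<lambda>j. (j - b) div p) at_top sequentially"
    unfolding filterlim_at_top
  proof
    fix Z :: nat
    have "Z \<le> (j - b) div p" if "j \<ge> Z * p + b" for j
      using div_le_mono[of "Z * p" "j - b" p] that assms by simp
    then show "\<forall>\<^sub>F j in sequentially. Z \<le> (j - b) div p"
      by (auto simp: eventually_sequentially)
  qed
  ultimately have lim: "(\<lambda>j. E ^ (p + b) * ((E ^ p) ^ ((j - b) div p) * (1 / 2) ^ (2 ^ ((j - b) div p)))) \<longlonglongrightarrow> 0"
    by (rule filterlim_compose)
  have "D ^ j * (1 / q) ^ (p ^ ((j - b) div p))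
      \<le> E ^ (p + b) * ((E ^ p) ^ ((j - b) div p) * (1 / 2) ^ (2 ^ ((j - b) div p)))" for j
  proof -
    define n where "n = (j - b) div p"
    have "j - b = p * n + (j - b) mod p"
      by (simp add: n_def)
    moreover have "(j - b) mod p < p"
      using assms by simp
    \<comment> \<open>Valid also for \<open>j < b\<close>, where the truncated difference and hence
      \<open>n\<close> are 0.\<close>
    ultimately have "j \<le> (p + b) + p * n"
      by linarith
    then have "D ^ j \<le> E ^ ((p + b) + p * n)"
      using E assms by (meson order.trans power_mono power_increasing less_imp_le)
    moreover have "(1 / q) ^ (p ^ n) \<le> (1 / 2) ^ (2 ^ n)"
    proof -
      have "(1 / q) ^ (p ^ n) \<le> (1 / 2) ^ (p ^ n)"
        using assms by (intro power_mono) (auto simp: field_simps)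
      also have "\<dots> \<le> (1 / 2) ^ (2 ^ n)"
        using assms by (intro power_decreasing power_mono) auto
      finally show ?thesis .
    qed
    ultimately have "D ^ j * (1 / q) ^ (p ^ n) \<le> E ^ ((p + b) + p * n) * (1 / 2) ^ (2 ^ n)"
      using E assms by (intro mult_mono) auto
    then show ?thesis
      by (simp add: power_add power_mult n_def mult_ac)
  qed
  then show ?thesis
    using assms by (intro tendsto_sandwich[OF _ _ tendsto_const lim] always_eventually allI) auto
qed


section \<open>Sums over polynomials of bounded degree\<close>

text \<open>Phrased through coefficients because \<open>degree v < j\<close> would lose the zero
  polynomial at \<open>j = 0\<close>. In this form every set is an additive group.\<close>

definition polys_below :: "nat \<Rightarrow> 'k::zero poly set" where
  "polys_below j = {v. \<forall>i\<ge>j. coeff v i = 0}"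

lemma polys_below_0: "polys_below 0 = {0}"
  by (auto simp: polys_below_def poly_eq_iff)

lemma degree_polys_below: "v \<in> polys_below (Suc n) \<Longrightarrow> degree v \<le> n"
  by (rule degree_le) (auto simp: polys_below_def)

text \<open>Splitting off the top coefficient makes a sum over polynomials an iterated sum, ready
  for induction on \<open>j\<close>.\<close>

lemma bij_betw_polys_below_Suc:
  "bij_betw (\<lambda>(c, v). v + monom c j) (UNIV \<times> polys_below j)
     (polys_below (Suc j) :: 'k::ab_group_add poly set)"
proof (rule bij_betwI[where g = "\<lambda>v. (coeff v j, v - monom (coeff v j) j)"])
  show "(\<lambda>v. (coeff v j, v - monom (coeff v j) j)) \<in> polys_below (Suc j) \<rightarrow> UNIV \<times> polys_below j"
    by (auto simp: polys_below_def Suc_le_eq)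
qed (auto simp: polys_below_def)

lemma finite_polys_below: "finite (polys_below j :: 'k::{ab_group_add,finite} poly set)"
proof (induction j)
  case (Suc j)
  then show ?case
    by (metis bij_betw_finite bij_betw_polys_below_Suc finite finite_cartesian_product)
qed (simp add: polys_below_0)

lemma sum_polys_below_Suc:
  "sum f (polys_below (Suc j) :: 'k::{ab_group_add,finite} poly set)
     = (\<Sum>c\<in>UNIV. \<Sum>v\<in>polys_below j. f (v + monom c j))"
  by (simp add: sum.cartesian_product case_prod_unfold
      flip: sum.reindex_bij_betw[OF bij_betw_polys_below_Suc])

text \<open>
  Each subset of the factors contributes, after expanding the product in the coefficient of
  \<open>monom c j\<close>, either a constant summed over all \<open>c\<close>, or a product with fewer factors.
\<close>

lemma sum_prod_additive_eq_0:
  fixes f :: "'i \<Rightarrow> 'k::{ab_group_add,finite} poly \<Rightarrow> 'c::comm_ring_1"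
  assumes "of_nat CARD('k) = (0 :: 'c)"
    and "finite I" "card I < j"
    and "\<And>i v w. i \<in> I \<Longrightarrow> f i (v + w) = f i v + f i w"
  shows "(\<Sum>v\<in>polys_below j. \<Prod>i\<in>I. f i (w + v)) = 0"
  using assms(2-4)
proof (induction j arbitrary: I)
  case (Suc j)
  have "(\<Prod>i\<in>I. f i (w + (v + monom c j)))
      = (\<Sum>X\<in>Pow I. (\<Prod>i\<in>X. f i (w + v)) * (\<Prod>i\<in>I - X. f i (monom c j)))" for v c
    using Suc.prems by (simp add: add.assoc flip: prod_add)
  then have "(\<Sum>v\<in>polys_below (Suc j). \<Prod>i\<in>I. f i (w + v))
      = (\<Sum>c\<in>UNIV. \<Sum>X\<in>Pow I. \<Sum>v\<in>polys_below j.
          (\<Prod>i\<in>X. f i (w + v)) * (\<Prod>i\<in>I - X. f i (monom c j)))"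
    unfolding sum_polys_below_Suc by (subst (2) sum.swap) simp
  also have "\<dots> = (\<Sum>X\<in>Pow I. \<Sum>c\<in>UNIV.
      (\<Sum>v\<in>polys_below j. \<Prod>i\<in>X. f i (w + v)) * (\<Prod>i\<in>I - X. f i (monom c j)))"
    by (subst sum.swap) (simp add: sum_distrib_right)
  also have "\<dots> = 0"
  proof (rule sum.neutral, rule ballI)
    fix X assume "X \<in> Pow I"
    show "(\<Sum>c\<in>UNIV. (\<Sum>v\<in>polys_below j. \<Prod>i\<in>X. f i (w + v)) * (\<Prod>i\<in>I - X. f i (monom c j))) = 0"
    proof (cases "X = I")
      case True
      then show ?thesis
        using assms(1) by simp
    next
      case False
      with \<open>X \<in> Pow I\<close> have "X \<subset> I" by blast
      then have "card X < j" "finite X"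
        using Suc.prems psubset_card_mono[of I X] finite_subset[of X I] by auto
      then have "(\<Sum>v\<in>polys_below j. \<Prod>i\<in>X. f i (w + v)) = 0"
        using Suc.prems(3) \<open>X \<subset> I\<close> by (intro Suc.IH) auto
      then show ?thesis by simp
    qed
  qed
  finally show ?case .
qed simp

text \<open>Lists allow repeated factors, as in a power of a single additive map; the positions in
  the list serve as the index set.\<close>

lemma sum_prod_list_additive_eq_0:
  fixes fs :: "('k::{ab_group_add,finite} poly \<Rightarrow> 'c::comm_ring_1) list"
  assumes "of_nat CARD('k) = (0 :: 'c)" "length fs < j"
    and "\<And>f v w. f \<in> set fs \<Longrightarrow> f (v + w) = f v + f w"
  shows "(\<Sum>v\<in>polys_below j. \<Prod>f\<leftarrow>fs. f (w + v)) = 0"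
  using sum_prod_additive_eq_0[of "{0..<length fs}" j "(!) fs" w] assms
  by (simp add: prod.list_conv_set_nth)

text \<open>
  In characteristic \<open>p\<close> the maps \<open>a \<mapsto> g a ^ p ^ i\<close> are again additive, so \<open>g a ^ N\<close> has as many
  additive factors as the sum of the base \<open>p\<close> digits of \<open>N\<close>.
\<close>

lemma power_eq_prod_list_additive:
  fixes g :: "'b::plus \<Rightarrow> 'c::comm_ring_1"
  assumes "prime p" "CHAR('c) = p" "N < p ^ n" "\<And>v w. g (v + w) = g v + g w"
  obtains fs where "length fs \<le> p * n" "\<And>f v w. f \<in> set fs \<Longrightarrow> f (v + w) = f v + f w"
    "\<And>a. g a ^ N = (\<Prod>f\<leftarrow>fs. f a)"
  using assms(3)
proof (induction n arbitrary: N thesis)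
  case 0
  then show ?case
    using "0.prems"(1)[of "[]"] by simp
next
  case (Suc n)
  have pos: "p > 0"
    using \<open>prime p\<close> by (simp add: prime_gt_0_nat)
  obtain fs where fs: "length fs \<le> p * n" "\<And>f v w. f \<in> set fs \<Longrightarrow> f (v + w) = f v + f w"
      "\<And>a. g a ^ (N mod p ^ n) = (\<Prod>f\<leftarrow>fs. f a)"
    using Suc.IH[of "N mod p ^ n"] pos by auto
  \<comment> \<open>The leading base \<open>p\<close> digit of \<open>N\<close>: it adds fewer than
    \<open>p\<close> copies of the Frobenius twist \<open>?h\<close>.\<close>
  let ?d = "N div p ^ n" and ?h = "\<lambda>a. g a ^ p ^ n"
  have d: "?d < p"
    using Suc.prems(2) by (simp add: less_mult_imp_div_less)
  have "g a ^ N = (\<Prod>f\<leftarrow>fs @ replicate ?d ?h. f a)" for a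
  proof -
    have "g a ^ N = g a ^ (N mod p ^ n + p ^ n * ?d)"
      by simp
    then show ?thesis
      unfolding power_add power_mult fs(3) by (simp add: prod_list_replicate)
  qed
  moreover have "?h (v + w) = ?h v + ?h w" for v w
    using freshmans_dream'[of "p ^ n" n "g v" "g w"] assms by simp
  ultimately show ?case
    using fs d by (intro Suc.prems(1)[of "fs @ replicate ?d ?h"]) auto
qed


section \<open>Powers of 1-units\<close>

lemma padic_ints_mod:
  assumes "y \<in> padic_ints p" "n \<le> m"
  shows "y m mod int p ^ n = y n"
  using assms(2)
proof (induction m rule: dec_induct)
  case base
  then show ?case
    using assms(1) by (auto simp: padic_ints_def)
next
  case (step m)
  have "y (Suc m) mod int p ^ n = (y (Suc m) mod int p ^ m) mod int p ^ n"
    using step.hyps by (simp add: mod_mod_cancel le_imp_power_dvd)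
  then show ?case
    using step.IH assms(1) by (auto simp: padic_ints_def)
qed

lemma padic_uminus_in_padic_ints:
  assumes "p > 0" "y \<in> padic_ints p"
  shows "padic_uminus p y \<in> padic_ints p"
proof -
  have "- y (Suc n) mod int p ^ Suc n mod int p ^ n = - y n mod int p ^ n" for n
  proof -
    have "- y (Suc n) mod int p ^ Suc n mod int p ^ n = - y (Suc n) mod int p ^ n"
      by (rule mod_mod_cancel) (simp add: le_imp_power_dvd)
    also have "\<dots> = - (y (Suc n) mod int p ^ n) mod int p ^ n"
      by (simp add: mod_minus_eq)
    finally show ?thesis
      using assms(2) by (auto simp: padic_ints_def)
  qed
  then show ?thesis
    using assms(1) by (auto simp: padic_ints_def padic_uminus_def)
qed

text \<open>Coordinates are continuous for the product topology and \<open>int\<close> is discrete.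
  This is how p-adic closeness enters the continuity proofs.\<close>

lemma eventually_padic_coordinate_eq:
  fixes y0 :: "nat \<Rightarrow> int"
  assumes "(f \<longlongrightarrow> y0) F"
  shows "\<forall>\<^sub>F s in F. f s n = y0 n"
  using continuous_on_tendsto_compose[OF continuous_on_product_coordinates assms, of n]
  unfolding tendsto_discrete by simp

lemma vabs_one_unit:
  fixes u :: "'c::nonarch_valued_field"
  assumes "vabs (u - 1) < 1"
  shows "vabs u = 1"
  using vabs_eq_of_diff_less[of u 1] assms by (simp add: vabs_one)

text \<open>For \<open>m \<ge> n\<close> the residue \<open>y m\<close> exceeds \<open>y n\<close>
  by some \<open>p ^ n * k\<close>, and Frobenius gives
  \<open>u ^ (p ^ n * k) - 1 = (u ^ k - 1) ^ (p ^ n)\<close>, where \<open>u ^ k - 1\<close> is no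
  larger than \<open>u - 1\<close>. The bound survives the limit in \<open>m\<close>.\<close>

lemma vabs_one_unit_pow_diff_le:
  fixes u :: "'c::{nonarch_valued_field,complete_space}"
  assumes "prime p" "CHAR('c) = p" "vabs (u - 1) \<le> r" "r < 1" "y \<in> padic_ints p"
  shows "vabs (one_unit_pow u y - u ^ nat (y n)) \<le> r ^ (p ^ n)"
proof (rule vabs_LIMSEQ_le)
  have lt: "vabs (u - 1) < 1"
    using assms by simp
  show "(\<lambda>m. u ^ nat (y m)) \<longlonglongrightarrow> one_unit_pow u y"
    by (rule one_unit_pow_convergent[OF assms(1,2) lt assms(5)])
  fix m assume "n \<le> m"
  have nonneg: "0 \<le> y n" "0 \<le> y m"
    using assms(5) by (auto simp: padic_ints_def)
  define k where "k = nat (y m div int p ^ n)"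
  have "y m = y n + int p ^ n * int k"
    using nonneg padic_ints_mod[OF assms(5) \<open>n \<le> m\<close>] mult_div_mod_eq[of "int p ^ n" "y m"]
    by (simp add: k_def div_int_pos_iff)
  then have "int (nat (y m)) = int (nat (y n) + p ^ n * k)"
    using nonneg by simp
  then have "nat (y m) = nat (y n) + p ^ n * k"
    by linarith
  then have "u ^ nat (y m) = u ^ nat (y n) * ((u ^ k - 1) + 1) ^ (p ^ n)"
    by (simp add: power_add mult.commute flip: power_mult)
  also have "((u ^ k - 1) + 1) ^ (p ^ n) = (u ^ k - 1) ^ (p ^ n) + 1"
    using freshmans_dream'[of "p ^ n" n "u ^ k - 1" 1] assms by simp
  finally have "vabs (u ^ nat (y m) - u ^ nat (y n)) = vabs (u ^ k - 1) ^ (p ^ n)"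
    by (simp add: algebra_simps vabs_mult vabs_power vabs_one_unit[OF lt])
  also have "\<dots> \<le> r ^ (p ^ n)"
    using vabs_power_diff_le[of u 1 1 k] assms vabs_one_unit[OF lt]
    by (intro power_mono) (auto simp: vabs_one vabs_nonneg)
  finally show "vabs (u ^ nat (y m) - u ^ nat (y n)) \<le> r ^ (p ^ n)" .
qed (rule tendsto_const)

lemma vabs_one_unit_pow:
  fixes u :: "'c::{nonarch_valued_field,complete_space}"
  assumes "prime p" "CHAR('c) = p" "vabs (u - 1) < 1" "y \<in> padic_ints p"
  shows "vabs (one_unit_pow u y) = 1"
proof -
  \<comment> \<open>Level 0 suffices: since \<open>p ^ 0 = 1\<close> the error is at most
    \<open>vabs (u - 1)\<close>, already less than the absolute value 1 of the ordinary
    power.\<close>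
  have "vabs (one_unit_pow u y - u ^ nat (y 0)) \<le> vabs (u - 1)"
    using vabs_one_unit_pow_diff_le[OF assms(1,2) order.refl assms(3,4), of 0] by simp
  then show ?thesis
    using vabs_eq_of_diff_less[of "one_unit_pow u y" "u ^ nat (y 0)"] assms(3)
    by (simp add: vabs_power vabs_one_unit)
qed


section \<open>The embedding of K\<close>

text \<open>Translation by 1 permutes the ring, so adding 1 to every element leaves the sum of all
  elements unchanged.\<close>

lemma of_nat_CARD_eq_0: "of_nat CARD('k) = (0 :: 'k::{ring_1,finite})"
proof -
  have "(\<Sum>x\<in>UNIV. x + 1 :: 'k) = (\<Sum>x\<in>UNIV. x)"
    by (rule sum.reindex_bij_witness[of _ "\<lambda>x. x - 1" "\<lambda>x. x + 1"]) auto
  then show ?thesis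
    by (simp add: sum.distrib)
qed

text \<open>Exhibits the monics as a translate of an additive group, the shape of the vanishing
  lemma with \<open>w = monom 1 j\<close>.\<close>

lemma A_plus_deg_eq: "A_plus_deg j = (\<lambda>v. monom 1 j + v) ` polys_below j"
proof (intro equalityI subsetI)
  fix a :: "'k::{field,finite} poly" assume "a \<in> A_plus_deg j"
  then have "a = monom 1 j + (a - monom 1 j)" "a - monom 1 j \<in> polys_below j"
    by (auto simp: A_plus_deg_def A_plus_def polys_below_def coeff_eq_0)
  then show "a \<in> (\<lambda>v. monom 1 j + v) ` polys_below j"
    by blast
next
  fix a :: "'k::{field,finite} poly" assume "a \<in> (\<lambda>v. monom 1 j + v) ` polys_below j"
  then obtain v where v: "a = monom 1 j + v" "\<And>i. i \<ge> j \<Longrightarrow> coeff v i = 0"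
    by (auto simp: polys_below_def)
  then have "degree a \<le> j" "coeff a j = 1"
    by (auto intro: degree_le)
  moreover from this have "degree a = j"
    by (metis le_antisym le_degree zero_neq_one)
  ultimately show "a \<in> A_plus_deg j"
    by (simp add: A_plus_deg_def A_plus_def)
qed

lemma finite_A_plus_deg: "finite (A_plus_deg j)"
  by (simp add: A_plus_deg_eq finite_polys_below)

lemma A_plus_in_A_plus_deg: "a \<in> A_plus \<Longrightarrow> a \<in> A_plus_deg (degree a)"
  by (simp add: A_plus_deg_def)

locale C_infinity =
  fixes \<iota> :: "'k::{field,finite} fls \<Rightarrow> 'c::{nonarch_valued_field,complete_space}"
    and p m0 :: nat
  assumes prime_p: "prime p"
    and card_k: "CARD('k) = p ^ m0"
    and C_inf: "is_C_infinity \<iota>"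
begin

section \<open>Homomorphism properties of \<iota> and the characteristic\<close>

lemma CARD_ge_2: "real CARD('k) \<ge> 2"
proof -
  have "card {0, 1 :: 'k} \<le> CARD('k)"
    by (rule card_mono) auto
  then show ?thesis by simp
qed

lemma p_ge_2: "p \<ge> 2"
  using prime_p by (rule prime_ge_2_nat)

lemma \<iota>_1: "\<iota> 1 = 1" and \<iota>_add: "\<iota> (f + g) = \<iota> f + \<iota> g"
  and \<iota>_mult: "\<iota> (f * g) = \<iota> f * \<iota> g" and vabs_\<iota>: "vabs (\<iota> f) = K_abs f"
  using C_inf by (auto simp: is_C_infinity_def)

lemma \<iota>_0: "\<iota> 0 = 0"
  using \<iota>_add[of 0 0] by (metis add.right_neutral add_left_cancel)

lemma \<iota>_power: "\<iota> (f ^ n) = \<iota> f ^ n"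
  by (induction n) (auto simp: \<iota>_1 \<iota>_mult)

lemma \<iota>_sum: "\<iota> (sum f I) = (\<Sum>i\<in>I. \<iota> (f i))"
  by (induction I rule: infinite_finite_induct) (auto simp: \<iota>_0 \<iota>_add)

lemma \<iota>_of_nat: "\<iota> (of_nat n) = of_nat n"
  by (induction n) (auto simp: \<iota>_0 \<iota>_1 \<iota>_add)

lemma \<iota>_divide: "\<iota> (f / g) = \<iota> f / \<iota> g"
proof (cases "g = 0")
  case False
  then have "\<iota> (f / g) * \<iota> g = \<iota> f"
    by (simp flip: \<iota>_mult)
  moreover have "\<iota> g \<noteq> 0"
    using False vabs_\<iota>[of g] by (auto simp: vabs_zero K_abs_def)
  ultimately show ?thesis
    by (simp add: field_simps)
qed (simp add: \<iota>_0)

lemma of_nat_card_k: "of_nat CARD('k) = (0 :: 'c)"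
proof -
  have "of_nat CARD('k) = \<iota> (fls_const (of_nat CARD('k)))"
    by (metis \<iota>_of_nat fls_of_nat)
  then show ?thesis
    by (simp only: of_nat_CARD_eq_0 fls_const_0 \<iota>_0)
qed

lemma CHAR_c: "CHAR('c) = p"
proof -
  \<comment> \<open>A field has no nilpotents, so this forces \<open>p\<close> itself to vanish in
    \<open>'c\<close>.\<close>
  have "of_nat p ^ m0 = (0 :: 'c)"
    using of_nat_card_k unfolding card_k by simp
  then have "CHAR('c) dvd p"
    by (simp add: of_nat_eq_0_iff_char_dvd[symmetric])
  moreover have "CHAR('c) \<noteq> 1"
    by simp
  ultimately show ?thesis
    using prime_p by (metis prime_nat_iff)
qed

lemma vabs_\<iota>_const_le: "vabs (\<iota> (fls_const c)) \<le> 1"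
  by (simp add: vabs_\<iota> K_abs_def)

section \<open>Evaluation at a point and the 1-units of monic polynomials\<close>

abbreviation \<theta> :: 'c where "\<theta> \<equiv> \<iota> fls_X_inv"

lemma vabs_theta: "vabs \<theta> = real CARD('k)"
  by (simp add: vabs_\<iota> K_abs_def)

lemma theta_neq_0: "\<theta> \<noteq> 0"
  using vabs_theta CARD_ge_2 by (auto simp: vabs_zero)

text \<open>The bound \<open>N\<close> is left free so that \<open>a\<close>, \<open>b\<close> and
  \<open>a + b\<close> can be expanded over one index range, which yields additivity.\<close>

lemma chi_conv_sum:
  assumes "degree a \<le> N"
  shows "chi \<iota> t a = (\<Sum>i\<le>N. \<iota> (fls_const (coeff a i)) * t ^ i)"
proof -
  have "degree (map_poly (\<lambda>c. \<iota> (fls_const c)) a) \<le> N"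
    using assms by (intro degree_le) (auto simp: coeff_map_poly \<iota>_0 coeff_eq_0)
  then have "chi \<iota> t a
      = (\<Sum>i\<le>N. coeff (map_poly (\<lambda>c. \<iota> (fls_const c)) a) i * t ^ i)"
    unfolding chi_def poly_altdef
    by (intro sum.mono_neutral_left) (auto simp: coeff_eq_0)
  then show ?thesis
    by (simp add: coeff_map_poly \<iota>_0)
qed

lemma chi_add: "chi \<iota> t (a + b) = chi \<iota> t a + chi \<iota> t b"
  unfolding chi_conv_sum[OF degree_add_le_max] chi_conv_sum[OF max.cobounded1[of "degree a" "degree b"]]
    chi_conv_sum[OF max.cobounded2[of "degree b" "degree a"]]
  by (simp add: \<iota>_add distrib_right flip: sum.distrib fls_plus_const)

lemma chi_monom: "chi \<iota> t (monom 1 j) = t ^ j"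
  by (simp add: chi_def map_poly_monom \<iota>_0 \<iota>_1 poly_monom)

lemma vabs_chi_le:
  assumes "degree a \<le> n"
  shows "vabs (chi \<iota> t a) \<le> max 1 (vabs t) ^ n"
  unfolding chi_conv_sum[OF assms]
proof (rule vabs_sum_le)
  fix i assume "i \<in> {..n}"
  have "vabs (\<iota> (fls_const (coeff a i)) * t ^ i) \<le> 1 * vabs t ^ i"
    unfolding vabs_mult vabs_power
    by (intro mult_mono vabs_\<iota>_const_le) (auto simp: vabs_nonneg)
  also have "\<dots> \<le> max 1 (vabs t) ^ i"
    by (simp add: power_mono vabs_nonneg)
  also have "\<dots> \<le> max 1 (vabs t) ^ n"
    using \<open>i \<in> {..n}\<close> by (intro power_increasing) auto
  finally show "vabs (\<iota> (fls_const (coeff a i)) * t ^ i) \<le> max 1 (vabs t) ^ n" .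
qed simp

text \<open>Makes the embedding of \<open>A\<close> another evaluation map, so the additivity and
  the bounds for \<open>chi\<close> apply to the bracket too.\<close>

lemma \<iota>_A_to_K: "\<iota> (A_to_K a) = chi \<iota> \<theta> a"
proof -
  have "A_to_K a = (\<Sum>i\<le>degree a. fls_const (coeff a i) * fls_X_inv ^ i)"
    by (simp add: A_to_K_def poly_altdef coeff_map_poly degree_map_poly)
  then show ?thesis
    by (simp add: chi_conv_sum[OF order.refl] \<iota>_sum \<iota>_mult \<iota>_power)
qed

lemma \<iota>_bracket: "\<iota> (bracket a) = chi \<iota> \<theta> a / \<theta> ^ degree a"
  unfolding bracket_def \<iota>_divide \<iota>_power \<iota>_A_to_K ..

text \<open>Removing the leading term of \<open>a\<close> leaves degree at most
  \<open>j - 1\<close>, hence size at most \<open>q ^ (j - 1)\<close> at \<theta>, against the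
  denominator of size \<open>q ^ j\<close>. In degree 0 nothing is left.\<close>

lemma vabs_bracket_diff_le:
  assumes "a \<in> A_plus"
  shows "vabs (\<iota> (bracket a) - 1) \<le> 1 / real CARD('k)"
proof -
  define j where "j = degree a"
  obtain v where v: "a = monom 1 j + v" "v \<in> polys_below j"
    using A_plus_in_A_plus_deg[OF assms] unfolding j_def A_plus_deg_eq by blast
  have "\<iota> (bracket a) - 1 = chi \<iota> \<theta> v / \<theta> ^ j"
    unfolding \<iota>_bracket j_def[symmetric] unfolding v(1) chi_add chi_monom
    using theta_neq_0 by (simp add: add_divide_distrib)
  then have *: "vabs (\<iota> (bracket a) - 1) = vabs (chi \<iota> \<theta> v) / real CARD('k) ^ j"
    by (simp add: vabs_divide vabs_power vabs_theta)
  show ?thesis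
  proof (cases j)
    case 0
    then show ?thesis
      using * v(2) by (simp add: polys_below_0 chi_def vabs_zero)
  next
    case (Suc n)
    then have "vabs (chi \<iota> \<theta> v) \<le> real CARD('k) ^ n"
      using vabs_chi_le[OF degree_polys_below, of v n \<theta>] v(2) CARD_ge_2 by (simp add: vabs_theta)
    then show ?thesis
      unfolding * Suc using CARD_ge_2 by (simp add: field_simps)
  qed
qed

lemma vabs_bracket_diff_less: "a \<in> A_plus \<Longrightarrow> vabs (\<iota> (bracket a) - 1) < 1"
  using CARD_ge_2 by (intro le_less_trans[OF vabs_bracket_diff_le]) auto

section \<open>Size and p-adic variation of the coefficients\<close>

lemma vabs_term_le:
  assumes "a \<in> A_plus_deg j" "y \<in> padic_ints p"
  shows "vabs (chi \<iota> t a ^ \<beta> * one_unit_pow (\<iota> (bracket a)) y) \<le> (max 1 (vabs t) ^ \<beta>) ^ j"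
proof -
  have a: "a \<in> A_plus" "degree a = j"
    using assms(1) by (auto simp: A_plus_deg_def)
  have "vabs (one_unit_pow (\<iota> (bracket a)) y) = 1"
    using vabs_one_unit_pow[OF prime_p CHAR_c vabs_bracket_diff_less[OF a(1)] assms(2)] .
  moreover have "vabs (chi \<iota> t a) ^ \<beta> \<le> (max 1 (vabs t) ^ j) ^ \<beta>"
    using a(2) by (intro power_mono vabs_chi_le) (auto simp: vabs_nonneg)
  ultimately show ?thesis
    by (simp add: vabs_mult vabs_power mult.commute flip: power_mult)
qed

lemma vabs_term_diff_le:
  assumes "a \<in> A_plus_deg j" "y \<in> padic_ints p"
  shows "vabs (chi \<iota> t a ^ \<beta> * one_unit_pow (\<iota> (bracket a)) y
      - chi \<iota> t a ^ \<beta> * \<iota> (bracket a) ^ nat (y n)) \<le> (max 1 (vabs t) ^ \<beta>) ^ j * (1 / real CARD('k)) ^ (p ^ n)"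
proof -
  have a: "a \<in> A_plus" "degree a = j"
    using assms(1) by (auto simp: A_plus_deg_def)
  have "vabs (one_unit_pow (\<iota> (bracket a)) y - \<iota> (bracket a) ^ nat (y n)) \<le> (1 / real CARD('k)) ^ (p ^ n)"
    using CARD_ge_2
    by (intro vabs_one_unit_pow_diff_le[OF prime_p CHAR_c vabs_bracket_diff_le[OF a(1)] _ assms(2)])
      (simp add: field_simps)
  moreover have "vabs (chi \<iota> t a) ^ \<beta> \<le> (max 1 (vabs t) ^ j) ^ \<beta>"
    using a(2) by (intro power_mono vabs_chi_le) (auto simp: vabs_nonneg)
  ultimately have "vabs (chi \<iota> t a ^ \<beta> * (one_unit_pow (\<iota> (bracket a)) y - \<iota> (bracket a) ^ nat (y n)))
      \<le> (max 1 (vabs t) ^ j) ^ \<beta> * (1 / real CARD('k)) ^ (p ^ n)"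
    unfolding vabs_mult vabs_power by (intro mult_mono) (auto simp: vabs_nonneg)
  then show ?thesis
    by (simp add: right_diff_distrib mult.commute flip: power_mult)
qed

lemma sum_truncated_eq_0:
  assumes "N < p ^ n" "\<beta> + p * n < j"
  shows "(\<Sum>a\<in>A_plus_deg j. chi \<iota> t a ^ \<beta> * \<iota> (bracket a) ^ N) = 0"
proof -
  \<comment> \<open>The fixed power \<open>\<theta> ^ j\<close> keeps \<open>?g\<close> additive,
    and agrees with \<open>\<theta> ^ degree a\<close> on the monics of degree
    \<open>j\<close>.\<close>
  let ?g = "\<lambda>a. chi \<iota> \<theta> a / \<theta> ^ j"
  obtain fs where fs: "length fs \<le> p * n" "\<And>f v w. f \<in> set fs \<Longrightarrow> f (v + w) = f v + f w"
      "\<And>a. ?g a ^ N = (\<Prod>f\<leftarrow>fs. f a)"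
    by (rule power_eq_prod_list_additive[OF prime_p CHAR_c assms(1), of ?g])
      (auto simp: chi_add add_divide_distrib)
  have "(\<Sum>a\<in>A_plus_deg j. chi \<iota> t a ^ \<beta> * \<iota> (bracket a) ^ N)
      = (\<Sum>a\<in>A_plus_deg j. \<Prod>f\<leftarrow>replicate \<beta> (chi \<iota> t) @ fs. f a)"
    by (intro sum.cong refl) (auto simp: \<iota>_bracket A_plus_deg_def prod_list_replicate simp flip: fs(3))
  also have "\<dots> = (\<Sum>v\<in>polys_below j. \<Prod>f\<leftarrow>replicate \<beta> (chi \<iota> t) @ fs. f (monom 1 j + v))"
    unfolding A_plus_deg_eq by (subst sum.reindex) auto
  also have "\<dots> = 0"
    using fs(1,2) assms(2)
    by (intro sum_prod_list_additive_eq_0[OF of_nat_card_k]) (auto simp: chi_add)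
  finally show ?thesis .
qed

text \<open>
  The leading factor \<open>q\<close> covers the degrees \<open>j \<le> \<beta>\<close>, for which \<open>j - Suc \<beta>\<close> truncates to 0.
\<close>

lemma vabs_pellarin_coeff_le:
  assumes "y \<in> padic_ints p"
  shows "vabs (pellarin_coeff p \<iota> \<beta> t y j)
    \<le> real CARD('k) * ((max 1 (vabs t) ^ \<beta>) ^ j * (1 / real CARD('k)) ^ (p ^ ((j - Suc \<beta>) div p)))"
proof -
  define B where "B = max 1 (vabs t) ^ \<beta>"
  \<comment> \<open>For \<open>j > \<beta>\<close> this is the largest \<open>n\<close> with
    \<open>\<beta> + p * n < j\<close>, the condition under which the truncated sum
    vanishes.\<close>
  define n where "n = (j - Suc \<beta>) div p"
  let ?z = "padic_uminus p y"
  have z: "?z \<in> padic_ints p"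
    using assms p_ge_2 by (simp add: padic_uminus_in_padic_ints)
  have "B \<ge> 1"
    by (simp add: B_def)
  then have nonneg: "0 \<le> B ^ j * (1 / real CARD('k)) ^ (p ^ n)"
    by simp
  show ?thesis
  proof (cases "j \<le> \<beta>")
    case True
    then have "n = 0" by (simp add: n_def)
    moreover have "vabs (pellarin_coeff p \<iota> \<beta> t y j) \<le> B ^ j"
      unfolding pellarin_coeff_def B_def by (intro vabs_sum_le vabs_term_le z) auto
    ultimately show ?thesis
      using CARD_ge_2 by (simp add: B_def n_def)
  next
    case False
    have "p * n \<le> j - Suc \<beta>"
      by (simp add: n_def)
    then have lt: "\<beta> + p * n < j"
      using False by linarith
    have "nat (?z n) < p ^ n"
      using z by (auto simp: padic_ints_def nat_less_iff)
    \<comment> \<open>The subtracted sum is 0, so the coefficient consists of approximation errors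
      only.\<close>
    then have "pellarin_coeff p \<iota> \<beta> t y j = (\<Sum>a\<in>A_plus_deg j.
        chi \<iota> t a ^ \<beta> * one_unit_pow (\<iota> (bracket a)) ?z - chi \<iota> t a ^ \<beta> * \<iota> (bracket a) ^ nat (?z n))"
      by (simp add: pellarin_coeff_def sum_subtractf sum_truncated_eq_0[OF _ lt])
    then have "vabs (pellarin_coeff p \<iota> \<beta> t y j) \<le> B ^ j * (1 / real CARD('k)) ^ (p ^ n)"
      using vabs_term_diff_le[OF _ z] nonneg by (auto intro!: vabs_sum_le simp: B_def)
    also have "\<dots> \<le> real CARD('k) * (B ^ j * (1 / real CARD('k)) ^ (p ^ n))"
      using nonneg CARD_ge_2 by (intro mult_right_mono[of 1 "real CARD('k)", simplified]) auto
    finally show ?thesis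
      by (simp add: B_def n_def)
  qed
qed

text \<open>Negation acts level by level, so \<open>-y\<close> and \<open>-y'\<close> share the
  residue at level \<open>n\<close>, and both 1-unit powers are close to the same ordinary
  power.\<close>

lemma vabs_pellarin_coeff_diff_le:
  assumes "y \<in> padic_ints p" "y' \<in> padic_ints p" "y n = y' n"
  shows "vabs (pellarin_coeff p \<iota> \<beta> t y j - pellarin_coeff p \<iota> \<beta> t y' j)
    \<le> (max 1 (vabs t) ^ \<beta>) ^ j * (1 / real CARD('k)) ^ (p ^ n)"
  unfolding pellarin_coeff_def sum_subtractf[symmetric]
proof (rule vabs_sum_le)
  fix a :: "'k poly" assume a: "a \<in> A_plus_deg j"
  have z: "padic_uminus p y \<in> padic_ints p" "padic_uminus p y' \<in> padic_ints p"
    using assms p_ge_2 by (simp_all add: padic_uminus_in_padic_ints)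
  have eq: "padic_uminus p y' n = padic_uminus p y n"
    using assms(3) by (simp add: padic_uminus_def)
  show "vabs (chi \<iota> t a ^ \<beta> * one_unit_pow (\<iota> (bracket a)) (padic_uminus p y)
      - chi \<iota> t a ^ \<beta> * one_unit_pow (\<iota> (bracket a)) (padic_uminus p y'))
    \<le> (max 1 (vabs t) ^ \<beta>) ^ j * (1 / real CARD('k)) ^ (p ^ n)"
    using vabs_diff_le[OF vabs_term_diff_le[OF a z(1), of t \<beta> n] vabs_term_diff_le[OF a z(2), of t \<beta> n]]
    by (simp add: eq)
qed simp


section \<open>The Pellarin L-series\<close>

text \<open>The coefficient bound does not involve \<open>y\<close>; absorbing \<open>R\<close> into
  the geometric base gives one null sequence for all \<open>y\<close>.\<close>

lemma pellarin_coeff_majorant: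
  assumes "R \<ge> 0"
  obtains M where "M \<longlonglongrightarrow> 0"
    and "\<And>y j. y \<in> padic_ints p \<Longrightarrow> vabs (pellarin_coeff p \<iota> \<beta> t y j) * R ^ j \<le> M j"
proof
  define B where "B = max 1 (vabs t) ^ \<beta>"
  define M where "M = (\<lambda>j. real CARD('k) * ((B * R) ^ j * (1 / real CARD('k)) ^ (p ^ ((j - Suc \<beta>) div p))))"
  have "B \<ge> 0"
    by (simp add: B_def)
  then show "M \<longlonglongrightarrow> 0"
    unfolding M_def using assms CARD_ge_2 p_ge_2
    by (intro tendsto_mult_right_zero LIMSEQ_superexponential) auto
  show "vabs (pellarin_coeff p \<iota> \<beta> t y j) * R ^ j \<le> M j" if "y \<in> padic_ints p" for y j
    using mult_right_mono[OF vabs_pellarin_coeff_le[OF that, of \<beta> t j], of "R ^ j"] \<open>R \<ge> 0\<close>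
    by (simp add: M_def B_def power_mult_distrib mult_ac)
qed

lemma summable_pellarin_coeff:
  assumes "y \<in> padic_ints p"
  shows "summable (\<lambda>j. pellarin_coeff p \<iota> \<beta> t y j * u ^ j)"
proof -
  obtain M where M: "M \<longlonglongrightarrow> 0"
    "\<And>y j. y \<in> padic_ints p \<Longrightarrow> vabs (pellarin_coeff p \<iota> \<beta> t y j) * vabs u ^ j \<le> M j"
    by (rule pellarin_coeff_majorant[OF vabs_nonneg[of u], of \<beta> t]) blast
  then have "(\<lambda>j. vabs (pellarin_coeff p \<iota> \<beta> t y j * u ^ j)) \<longlonglongrightarrow> 0"
    using assms by (intro tendsto_sandwich[OF _ _ tendsto_const M(1)])
      (auto simp: vabs_nonneg vabs_mult vabs_power)
  then show ?thesis
    by (rule summable_of_vabs_tendsto_0)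
qed

text \<open>From degree \<open>J\<close> on, both series have small terms by the common majorant. In
  the finitely many lower degrees, agreement at a high level \<open>n\<close> makes the coefficients
  close.\<close>

lemma pellarin_series_equicontinuous:
  assumes "e > 0"
  obtains n where "\<And>y y' u. y \<in> padic_ints p \<Longrightarrow> y' \<in> padic_ints p \<Longrightarrow> y n = y' n \<Longrightarrow> vabs u \<le> R \<Longrightarrow>
    vabs ((\<Sum>j. pellarin_coeff p \<iota> \<beta> t y j * u ^ j) - (\<Sum>j. pellarin_coeff p \<iota> \<beta> t y' j * u ^ j)) \<le> e"
proof -
  \<comment> \<open>Ensures \<open>B * R' \<ge> 1\<close>, so its \<open>J\<close>-th power
    dominates the lower ones.\<close>
  define R' where "R' = max 1 R"
  have R': "R' \<ge> 1" "R \<le> R'"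
    by (auto simp: R'_def)
  then have "R' \<ge> 0" by simp
  obtain M where M: "M \<longlonglongrightarrow> 0"
    "\<And>y j. y \<in> padic_ints p \<Longrightarrow> vabs (pellarin_coeff p \<iota> \<beta> t y j) * R' ^ j \<le> M j"
    by (rule pellarin_coeff_majorant[OF \<open>R' \<ge> 0\<close>, of \<beta> t]) blast
  obtain J where J: "\<And>j. j \<ge> J \<Longrightarrow> M j < e"
    using order_tendstoD(2)[OF M(1) \<open>e > 0\<close>] unfolding eventually_sequentially by blast
  define B where "B = max 1 (vabs t) ^ \<beta>"
  define r where "r = 1 / real CARD('k)"
  have B: "B \<ge> 1"
    by (simp add: B_def)
  have BR: "B * R' \<ge> 1"
    using mult_mono[of 1 B 1 R'] B R' by simp
  then have "e / (B * R') ^ J > 0"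
    using \<open>e > 0\<close> by simp
  moreover have r: "0 \<le> r" "r < 1"
    using CARD_ge_2 by (auto simp: r_def)
  ultimately obtain n where n: "r ^ n < e / (B * R') ^ J"
    using real_arch_pow_inv by blast
  \<comment> \<open>The crude comparison of \<open>p ^ n\<close> with \<open>n\<close> is enough to
    make the error small.\<close>
  have "r ^ (p ^ n) \<le> r ^ n"
    using r power_gt_expt[of p n] p_ge_2 by (intro power_decreasing) auto
  also note n
  finally have "(B * R') ^ J * r ^ (p ^ n) < e"
    using BR by (simp add: pos_less_divide_eq mult.commute)
  then have small: "(B * R') ^ J * r ^ (p ^ n) \<le> e" by simp
  show ?thesis
  proof (rule that)
    fix y y' and u :: 'c assume y: "y \<in> padic_ints p" "y' \<in> padic_ints p" "y n = y' n" and u: "vabs u \<le> R"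
    then have u': "vabs u \<le> R'" using R' by simp
    show "vabs ((\<Sum>j. pellarin_coeff p \<iota> \<beta> t y j * u ^ j) - (\<Sum>j. pellarin_coeff p \<iota> \<beta> t y' j * u ^ j)) \<le> e"
    proof (intro vabs_suminf_diff_le summable_pellarin_coeff y)
      fix j
      show "vabs (pellarin_coeff p \<iota> \<beta> t y j * u ^ j - pellarin_coeff p \<iota> \<beta> t y' j * u ^ j) \<le> e"
      proof (cases "j \<ge> J")
        case True
        then have "M j \<le> e" using J by (simp add: less_imp_le)
        then show ?thesis
          by (intro vabs_diff_le vabs_mult_power_le[OF u'] order.trans[OF M(2)] y)
      next
        case False
        have "vabs (pellarin_coeff p \<iota> \<beta> t y j - pellarin_coeff p \<iota> \<beta> t y' j) * R' ^ j
            \<le> (B ^ j * r ^ (p ^ n)) * R' ^ j"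
          unfolding B_def r_def using R'
          by (intro mult_right_mono vabs_pellarin_coeff_diff_le y) auto
        also have "\<dots> = (B * R') ^ j * r ^ (p ^ n)"
          by (simp add: power_mult_distrib)
        also have "\<dots> \<le> (B * R') ^ J * r ^ (p ^ n)"
          using False BR r by (intro mult_right_mono power_increasing) auto
        also note small
        finally have "vabs ((pellarin_coeff p \<iota> \<beta> t y j - pellarin_coeff p \<iota> \<beta> t y' j) * u ^ j) \<le> e"
          by (rule vabs_mult_power_le[OF u'])
        then show ?thesis
          by (simp only: left_diff_distrib)
      qed
    qed
  qed
qed

text \<open>The weighted coefficients tend to 0 and are therefore bounded; such a bound is a
  Lipschitz constant, since \<open>u ^ j - v ^ j\<close> costs only
  \<open>R ^ j * vabs (u - v)\<close>.\<close>

lemma pellarin_series_lipschitz: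
  assumes "y \<in> padic_ints p" "R \<ge> 1"
  obtains C where "C > 0" "\<And>u v. vabs u \<le> R \<Longrightarrow> vabs v \<le> R \<Longrightarrow>
    vabs ((\<Sum>j. pellarin_coeff p \<iota> \<beta> t y j * u ^ j) - (\<Sum>j. pellarin_coeff p \<iota> \<beta> t y j * v ^ j))
      \<le> C * vabs (u - v)"
proof -
  have "R \<ge> 0" using assms(2) by simp
  obtain M where M: "M \<longlonglongrightarrow> 0"
    "\<And>y j. y \<in> padic_ints p \<Longrightarrow> vabs (pellarin_coeff p \<iota> \<beta> t y j) * R ^ j \<le> M j"
    by (rule pellarin_coeff_majorant[OF \<open>R \<ge> 0\<close>, of \<beta> t]) blast
  have "Bseq M"
    using M(1) by (intro convergent_imp_Bseq convergentI)
  then obtain C where C: "C > 0" "\<And>j. norm (M j) \<le> C"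
    by (auto elim: BseqE)
  show ?thesis
  proof (rule that[OF C(1)])
    fix u v :: 'c assume uv: "vabs u \<le> R" "vabs v \<le> R"
    show "vabs ((\<Sum>j. pellarin_coeff p \<iota> \<beta> t y j * u ^ j) - (\<Sum>j. pellarin_coeff p \<iota> \<beta> t y j * v ^ j))
      \<le> C * vabs (u - v)"
    proof (intro vabs_suminf_diff_le summable_pellarin_coeff assms(1))
      fix j
      have "vabs (pellarin_coeff p \<iota> \<beta> t y j * (u ^ j - v ^ j))
          \<le> vabs (pellarin_coeff p \<iota> \<beta> t y j) * (R ^ j * vabs (u - v))"
        unfolding vabs_mult
        by (intro mult_left_mono vabs_power_diff_le[OF uv assms(2)] vabs_nonneg)
      also have "\<dots> = (vabs (pellarin_coeff p \<iota> \<beta> t y j) * R ^ j) * vabs (u - v)"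
        by simp
      also have "\<dots> \<le> C * vabs (u - v)"
        using order.trans[OF M(2)[OF assms(1), of j], of C] C(2)[of j]
        by (intro mult_right_mono vabs_nonneg) auto
      finally show "vabs (pellarin_coeff p \<iota> \<beta> t y j * u ^ j - pellarin_coeff p \<iota> \<beta> t y j * v ^ j)
          \<le> C * vabs (u - v)"
        by (simp only: right_diff_distrib)
    qed
  qed
qed

lemma uniform_limit_pellarin_series:
  assumes "y0 \<in> padic_ints p"
  shows "uniform_limit (cball 0 R) (\<lambda>y u. \<Sum>j. pellarin_coeff p \<iota> \<beta> t y j * u ^ j)
    (\<lambda>u. \<Sum>j. pellarin_coeff p \<iota> \<beta> t y0 j * u ^ j) (at y0 within padic_ints p)"
proof (rule uniform_limitI)
  fix e :: real assume "e > 0"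
  then have "e / 2 > 0" by simp
  then obtain n where n: "\<And>y y' u. y \<in> padic_ints p \<Longrightarrow> y' \<in> padic_ints p \<Longrightarrow> y n = y' n \<Longrightarrow> vabs u \<le> R \<Longrightarrow>
      vabs ((\<Sum>j. pellarin_coeff p \<iota> \<beta> t y j * u ^ j) - (\<Sum>j. pellarin_coeff p \<iota> \<beta> t y' j * u ^ j)) \<le> e / 2"
    by (rule pellarin_series_equicontinuous[of "e / 2" R \<beta> t]) blast
  have "\<forall>\<^sub>F y in at y0 within padic_ints p. y n = y0 n \<and> y \<in> padic_ints p"
    by (intro eventually_conj eventually_padic_coordinate_eq tendsto_ident_at)
      (simp add: eventually_at_filter)
  then show "\<forall>\<^sub>F y in at y0 within padic_ints p. \<forall>u\<in>cball 0 R.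
      dist (\<Sum>j. pellarin_coeff p \<iota> \<beta> t y j * u ^ j) (\<Sum>j. pellarin_coeff p \<iota> \<beta> t y0 j * u ^ j) < e"
  proof eventually_elim
    case (elim y)
    show ?case
    proof
      fix u :: 'c assume "u \<in> cball 0 R"
      then have "vabs u \<le> R"
        by (simp add: dist_vabs vabs_minus)
      then show "dist (\<Sum>j. pellarin_coeff p \<iota> \<beta> t y j * u ^ j) (\<Sum>j. pellarin_coeff p \<iota> \<beta> t y0 j * u ^ j) < e"
        using n[of y y0 u] elim assms \<open>e > 0\<close> by (simp add: dist_vabs)
    qed
  qed
qed

text \<open>The path from \<open>(x, y)\<close> to \<open>(x0, y0)\<close> first changes
  \<open>y\<close> at fixed \<open>x\<close>, by equicontinuity, and then \<open>x\<close> at fixed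
  \<open>y0\<close>, by the Lipschitz bound.\<close>

lemma continuous_on_pellarin_series:
  "continuous_on (S_infinity p) (\<lambda>(x, y). \<Sum>j. pellarin_coeff p \<iota> \<beta> t y j * inverse x ^ j)"
  unfolding continuous_on_def
proof (rule ballI, rule tendstoI)
  fix s0 :: "'c \<times> (nat \<Rightarrow> int)" and e :: real
  assume s0: "s0 \<in> S_infinity p" and "e > 0"
  define x0 y0 where "x0 = fst s0" "y0 = snd s0"
  have xy: "s0 = (x0, y0)" "x0 \<noteq> 0" "y0 \<in> padic_ints p"
    using s0 by (auto simp: S_infinity_def x0_y0_def)
  have x0: "vabs x0 > 0"
    using xy(2) vabs_nonneg[of x0] by (simp add: less_le vabs_eq_0_iff)
  define R where "R = max 1 (vabs (inverse x0))"
  obtain C where C: "C > 0" "\<And>u v. vabs u \<le> R \<Longrightarrow> vabs v \<le> R \<Longrightarrow>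
      vabs ((\<Sum>j. pellarin_coeff p \<iota> \<beta> t y0 j * u ^ j) - (\<Sum>j. pellarin_coeff p \<iota> \<beta> t y0 j * v ^ j))
        \<le> C * vabs (u - v)"
    by (rule pellarin_series_lipschitz[OF xy(3), of R \<beta> t]) (auto simp: R_def)
  have "e / 2 > 0" using \<open>e > 0\<close> by simp
  then obtain n where n: "\<And>y y' u. y \<in> padic_ints p \<Longrightarrow> y' \<in> padic_ints p \<Longrightarrow> y n = y' n \<Longrightarrow> vabs u \<le> R \<Longrightarrow>
      vabs ((\<Sum>j. pellarin_coeff p \<iota> \<beta> t y j * u ^ j) - (\<Sum>j. pellarin_coeff p \<iota> \<beta> t y' j * u ^ j)) \<le> e / 2"
    by (rule pellarin_series_equicontinuous[of "e / 2" R \<beta> t]) blast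
  \<comment> \<open>The first entry forces \<open>vabs x = vabs x0\<close>, keeping
    \<open>inverse x\<close> in the ball of radius \<open>R\<close>. The second makes
    \<open>C * vabs (x - x0) / (vabs x0)\<^sup>2\<close> at most \<open>e / 2\<close>.\<close>
  define d where "d = min (vabs x0) (e / 2 * (vabs x0)\<^sup>2 / C)"
  have "d > 0"
    using x0 \<open>e > 0\<close> C(1) by (simp add: d_def)
  have "(fst \<longlongrightarrow> x0) (at s0 within S_infinity p)" "(snd \<longlongrightarrow> y0) (at s0 within S_infinity p)"
    unfolding x0_y0_def by (intro tendsto_intros)+
  then have "\<forall>\<^sub>F s in at s0 within S_infinity p. dist (fst s) x0 < d \<and> snd s n = y0 n \<and> s \<in> S_infinity p"
    using \<open>d > 0\<close>
    by (intro eventually_conj tendstoD eventually_padic_coordinate_eq) (auto simp: eventually_at_filter)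
  then show "\<forall>\<^sub>F s in at s0 within S_infinity p.
      dist (case s of (x, y) \<Rightarrow> \<Sum>j. pellarin_coeff p \<iota> \<beta> t y j * inverse x ^ j)
        (case s0 of (x, y) \<Rightarrow> \<Sum>j. pellarin_coeff p \<iota> \<beta> t y j * inverse x ^ j) < e"
  proof eventually_elim
    case (elim s)
    obtain x y where s: "s = (x, y)"
      by (cases s)
    have x: "vabs (x - x0) < d" and y: "y n = y0 n" "y \<in> padic_ints p"
      using elim by (auto simp: s dist_vabs S_infinity_def)
    then have eq: "vabs x = vabs x0"
      by (intro vabs_eq_of_diff_less) (simp add: d_def)
    then have "x \<noteq> 0"
      using x0 by (auto simp: vabs_zero)
    then have "inverse x - inverse x0 = (x0 - x) / (x * x0)"
      using xy(2) by (simp add: field_simps)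
    then have "vabs (inverse x - inverse x0) = vabs (x - x0) / (vabs x0)\<^sup>2"
      by (simp add: vabs_divide vabs_mult eq vabs_diff_commute[of x0] power2_eq_square)
    moreover have "vabs (x - x0) \<le> e / 2 * (vabs x0)\<^sup>2 / C"
      using x by (simp add: d_def)
    ultimately have "C * vabs (inverse x - inverse x0) \<le> e / 2"
      using C(1) x0 by (simp add: pos_divide_le_eq pos_le_divide_eq mult_ac)
    moreover have R: "vabs (inverse x) \<le> R" "vabs (inverse x0) \<le> R"
      by (simp_all add: R_def vabs_inverse eq)
    ultimately have "vabs ((\<Sum>j. pellarin_coeff p \<iota> \<beta> t y0 j * inverse x ^ j)
        - (\<Sum>j. pellarin_coeff p \<iota> \<beta> t y0 j * inverse x0 ^ j)) \<le> e / 2"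
      using C(2) order.trans by blast
    from vabs_add_le[OF n[OF y(2) xy(3) y(1) R(1)] this] show ?case
      using \<open>e > 0\<close> by (simp add: s xy(1) dist_vabs)
  qed
qed

text \<open>A term of degree \<open>j\<close> is at most \<open>(B / vabs x) ^ j\<close>. By the
  ultrametric inequality any finite set of terms of degree at least \<open>J\<close> is then
  uniformly small, which gives unordered summation.\<close>

lemma has_sum_pellarin_term:
  assumes "(x, y) \<in> S_infinity p" "vabs x > max 1 (vabs t) ^ \<beta>"
  shows "(pellarin_term p \<iota> \<beta> t (x, y) has_sum (\<Sum>j. pellarin_coeff p \<iota> \<beta> t y j * inverse x ^ j)) A_plus"
  unfolding has_sum_def
proof (rule tendstoI)
  fix e :: real assume "e > 0"
  define B where "B = max 1 (vabs t) ^ \<beta>"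
  have B: "B \<ge> 1" "B < vabs x"
    using assms(2) by (simp_all add: B_def)
  have y: "y \<in> padic_ints p" and "padic_uminus p y \<in> padic_ints p"
    using assms(1) p_ge_2 by (auto simp: S_infinity_def intro: padic_uminus_in_padic_ints)
  define g where "g a = pellarin_term p \<iota> \<beta> t (x, y) a" for a
  have g: "g a = inverse x ^ j * (chi \<iota> t a ^ \<beta> * one_unit_pow (\<iota> (bracket a)) (padic_uminus p y))"
    if "a \<in> A_plus_deg j" for a j
    using that by (simp add: g_def pellarin_term_def S_pow_def S_uminus_def A_plus_deg_def)
  have coeff: "(\<Sum>a\<in>A_plus_deg j. g a) = pellarin_coeff p \<iota> \<beta> t y j * inverse x ^ j" for j
    by (simp add: g pellarin_coeff_def sum_distrib_left mult.commute[of _ "inverse x ^ j"])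
  have g_le: "vabs (g a) \<le> (B / vabs x) ^ j" if a: "a \<in> A_plus_deg j" for a j
  proof -
    have "vabs (g a) \<le> inverse (vabs x) ^ j * B ^ j"
      unfolding g[OF a] vabs_mult[of "inverse x ^ j"] B_def
      using vabs_term_le[OF a \<open>padic_uminus p y \<in> padic_ints p\<close>]
      by (simp add: vabs_power vabs_inverse vabs_nonneg mult_left_mono)
    then show ?thesis
      by (simp add: power_divide divide_inverse power_mult_distrib mult.commute)
  qed
  obtain J where J: "(B / vabs x) ^ J < e / 2"
    using real_arch_pow_inv[of "e / 2" "B / vabs x"] B \<open>e > 0\<close> by auto
  have tail: "(B / vabs x) ^ j \<le> e / 2" if "j \<ge> J" for j
  proof -
    have "(B / vabs x) ^ j \<le> (B / vabs x) ^ J"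
      using that B by (intro power_decreasing) auto
    then show ?thesis
      using J by simp
  qed
  define X0 where "X0 = (\<Union>j<J. A_plus_deg j :: 'k poly set)"
  have X0: "finite X0" "X0 \<subseteq> A_plus"
    unfolding X0_def by (intro finite_UN_I finite_lessThan finite_A_plus_deg) (auto simp: A_plus_deg_def)
  have sum_X0: "sum g X0 = (\<Sum>j<J. pellarin_coeff p \<iota> \<beta> t y j * inverse x ^ j)"
    unfolding X0_def coeff[symmetric]
    by (intro sum.UNION_disjoint finite_lessThan ballI finite_A_plus_deg) (auto simp: A_plus_deg_def)
  show "\<forall>\<^sub>F X in finite_subsets_at_top A_plus.
      dist (sum (pellarin_term p \<iota> \<beta> t (x, y)) X) (\<Sum>j. pellarin_coeff p \<iota> \<beta> t y j * inverse x ^ j) < e"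
    unfolding eventually_finite_subsets_at_top
  proof (intro exI[of _ X0] conjI allI impI X0)
    fix X :: "'k poly set" assume X: "finite X \<and> X0 \<subseteq> X \<and> X \<subseteq> A_plus"
    have "vabs (g a) \<le> e / 2" if "a \<in> X - X0" for a
    proof -
      have "a \<in> A_plus_deg (degree a)"
        using that X A_plus_in_A_plus_deg by blast
      moreover from this have "degree a \<ge> J"
        using that by (force simp: X0_def)
      ultimately show ?thesis
        using g_le tail order.trans by blast
    qed
    then have "vabs (sum g (X - X0)) \<le> e / 2"
      using \<open>e > 0\<close> by (intro vabs_sum_le) auto
    then have "vabs (sum g X - sum g X0) \<le> e / 2"
      using X by (simp add: sum_diff)
    moreover have "vabs ((\<Sum>j. pellarin_coeff p \<iota> \<beta> t y j * inverse x ^ j) - sum g X0) \<le> e / 2"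
      unfolding sum_X0
    proof (intro vabs_suminf_tail_le summable_pellarin_coeff y)
      fix j assume "j \<ge> J"
      show "vabs (pellarin_coeff p \<iota> \<beta> t y j * inverse x ^ j) \<le> e / 2"
        \<comment> \<open>Each term of the series is the sum over one degree, so the termwise bound
          carries over.\<close>
        unfolding coeff[symmetric]
        using \<open>e > 0\<close> order.trans[OF g_le tail[OF \<open>j \<ge> J\<close>]] by (intro vabs_sum_le) auto
    qed (use \<open>e > 0\<close> in auto)
    ultimately have "vabs (sum g X - (\<Sum>j. pellarin_coeff p \<iota> \<beta> t y j * inverse x ^ j)) \<le> e / 2"
      using vabs_diff_le by fastforce
    then show "dist (sum (pellarin_term p \<iota> \<beta> t (x, y)) X) (\<Sum>j. pellarin_coeff p \<iota> \<beta> t y j * inverse x ^ j) < e"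
      using \<open>e > 0\<close> by (simp add: dist_vabs g_def)
  qed
qed

end

theorem theorem4p2:
  fixes \<iota> :: "'k::{field,finite} fls \<Rightarrow> 'c::{nonarch_valued_field,complete_space}"
    and p m0 \<beta> :: nat and t :: 'c
  assumes "prime p" and "CARD('k) = p ^ m0"
    and "is_C_infinity \<iota>"
  shows
    "(\<forall>y\<in>padic_ints p. entire_power_series (pellarin_coeff p \<iota> \<beta> t y)) \<and>
     entire_on_S_infinity p (\<lambda>(x, y). \<Sum>j. inverse x ^ j * pellarin_coeff p \<iota> \<beta> t y j) \<and>
     (\<forall>(x, y)\<in>S_infinity p. vabs x > max 1 (vabs t) ^ \<beta> \<longrightarrow>
        pellarin_term p \<iota> \<beta> t (x, y) summable_on (A_plus :: 'k poly set) \<and>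
        pellarin_L p \<iota> \<beta> t (x, y) = (\<Sum>j. inverse x ^ j * pellarin_coeff p \<iota> \<beta> t y j))"
proof -
  interpret C_infinity \<iota> p m0
    by unfold_locales (fact assms)+
  have entire: "\<forall>y\<in>padic_ints p. entire_power_series (pellarin_coeff p \<iota> \<beta> t y)"
    by (simp add: entire_power_series_def summable_pellarin_coeff)
  moreover have "entire_on_S_infinity p (\<lambda>(x, y). \<Sum>j. inverse x ^ j * pellarin_coeff p \<iota> \<beta> t y j)"
    \<comment> \<open>Commuting the factors matches the form \<open>c y j * u ^ j\<close> of the
      definition, with the Pellarin coefficients as the family \<open>c\<close>.\<close>
    unfolding entire_on_S_infinity_def mult.commute[of "inverse _ ^ _"]
    using entire uniform_limit_pellarin_series continuous_on_pellarin_series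
    by (intro conjI exI[of _ "pellarin_coeff p \<iota> \<beta> t"]) auto
  moreover have "\<forall>(x, y)\<in>S_infinity p. vabs x > max 1 (vabs t) ^ \<beta> \<longrightarrow>
      pellarin_term p \<iota> \<beta> t (x, y) summable_on (A_plus :: 'k poly set) \<and>
      pellarin_L p \<iota> \<beta> t (x, y) = (\<Sum>j. inverse x ^ j * pellarin_coeff p \<iota> \<beta> t y j)"
    unfolding pellarin_L_def mult.commute[of "inverse _ ^ _"]
    using has_sum_pellarin_term by (blast intro: has_sum_imp_summable infsumI)
  ultimately show ?thesis
    by blast
qed

end
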